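(* For every integer $n\geq 3$, writing $f_q(n)$ for the total number of occurrences of the pattern $q$ in all permutations of $S_n(132,312)$, we have $$f_{123}(n)=f_{321}(n)=\binom{n}{3}2^{n-3},$$ $$f_{213}(n)=f_{231}(n)=\binom{n}{3}2^{n-3}.$$
   Context: $S_n$ is the set of permutations of $\{1,\dots,n\}$ written in one-line notation $\sigma=\sigma_1\sigma_2\cdots\sigma_n$. For $q\in S_k$, an occurrence of the pattern $q$ in $\sigma\in S_n$ is a choice of indices $i_1<i_2<\cdots<i_k$ in $\{1,\dots,n\}$ such that for all $1\le j,l\le k$, $q_j<q_l$ if and only if $\sigma_{i_j}<\sigma_{i_l}$. Let $f_q(\sigma)$ be the number of occurrences of $q$ in $\sigma$; $\sigma$ avoids $q$ if $f_q(\sigma)=0$. $S_n(132,312)$ is the set of permutations in $S_n$ avoiding both $132$ and $312$, and $f_q(n)=\sum_{\sigma\in S_n(132,312)}f_q(\sigma)$. *)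

theory Defs
  imports "HOL-Combinatorics.Multiset_Permutations"
begin

text \<open>
  Permutations and patterns are lists of natural numbers in one-line notation, with values
  in \<open>{1..n}\<close>.  Since list positions are numbered from 0, the indices
  \<open>i\<^sub>1 < \<dots> < i\<^sub>k\<close> of an occurrence range over \<open>{0..<n}\<close> instead of \<open>{1..n}\<close>; the choice
  of indices is a strictly increasing list.
\<close>

abbreviation perms :: "nat \<Rightarrow> nat list set" where
  "perms n \<equiv> permutations_of_set {1..n}"

definition occurrences :: "nat list \<Rightarrow> nat list \<Rightarrow> nat list set" where
  "occurrences q \<sigma> =
     {i. length i = length q \<and> set i \<subseteq> {0..<length \<sigma>} \<and> sorted_wrt (<) i \<and>
         (\<forall>j<length q. \<forall>l<length q. q ! j < q ! l \<longleftrightarrow> \<sigma> ! (i ! j) < \<sigma> ! (i ! l))}"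

definition num_occ :: "nat list \<Rightarrow> nat list \<Rightarrow> nat" where
  "num_occ q \<sigma> = card (occurrences q \<sigma>)"

definition avoids :: "nat list \<Rightarrow> nat list \<Rightarrow> bool" where
  "avoids \<sigma> q \<longleftrightarrow> num_occ q \<sigma> = 0"

definition avoiders :: "nat \<Rightarrow> nat list set \<Rightarrow> nat list set" where
  "avoiders n Q = {\<sigma> \<in> perms n. \<forall>q\<in>Q. avoids \<sigma> q}"

definition total_occ :: "nat list \<Rightarrow> nat \<Rightarrow> nat" where
  "total_occ q n = (\<Sum>\<sigma>\<in>avoiders n {[1,3,2], [3,1,2]}. num_occ q \<sigma>)"

text \<open>The set of occurrences is finite, so the cardinality in \<^const>\<open>num_occ\<close> is a genuine count.\<close>

lemma finite_occurrences: "finite (occurrences q \<sigma>)"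
proof (rule finite_subset)
  show "occurrences q \<sigma> \<subseteq> {i. set i \<subseteq> {0..<length \<sigma>} \<and> length i = length q}"
    by (auto simp: occurrences_def)
  show "finite {i. set i \<subseteq> {0..<length \<sigma>} \<and> length i = length q}"
    by (rule finite_lists_length_eq) simp
qed

end

theory Submission
  imports Defs
begin

text \<open>
  A permutation avoids 132 and 312 iff no entry lies strictly between two earlier ones, that is,
  iff each entry is a left-to-right maximum or a left-to-right minimum.  Such a permutation is
  determined by the set of positions \<open>k > 0\<close> holding left-to-right maxima, and this set is
  arbitrary.  The pattern formed at positions \<open>i < j < k\<close> depends only on which of \<open>j\<close> and \<open>k\<close>
  belong to the set, so each of the four possible patterns occurs there in \<open>2 ^ (n - 3)\<close>
  permutations.
\<close>

text \<open>Comparing with the first entry alone is enough: in an avoider, an entry above the first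
  one is above all earlier ones. Position 0 is left out because it is trivially both a maximum and a
  minimum.\<close>

definition max_positions :: "nat \<Rightarrow> nat list \<Rightarrow> nat set" where
  "max_positions n \<sigma> = {k \<in> {1..<n}. \<sigma> ! 0 < \<sigma> ! k}"

section \<open>Permutations and the relative order of their entries\<close>

lemma perms_length: "\<sigma> \<in> perms n \<Longrightarrow> length \<sigma> = n"
  by (simp add: length_finite_permutations_of_set)

lemma perms_nth_eq_iff:
  assumes "\<sigma> \<in> perms n" "i < n" "j < n"
  shows "\<sigma> ! i = \<sigma> ! j \<longleftrightarrow> i = j"
  using assms perms_length[OF assms(1)]
  by (simp add: nth_eq_iff_index_eq permutations_of_setD(2))

text \<open>The values fill \<open>{1..n}\<close>, so the entries below \<open>\<sigma> ! i\<close>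
  are exactly \<open>1, ..., \<sigma> ! i - 1\<close>; \<open>Suc\<close> appears because values
  start at 1.\<close>

lemma perms_nth_eq_rank:
  assumes \<sigma>: "\<sigma> \<in> perms n" and i: "i < n"
  shows "\<sigma> ! i = Suc (card {k. k < n \<and> \<sigma> ! k < \<sigma> ! i})"
proof -
  have len: "length \<sigma> = n" using \<sigma> by (rule perms_length)
  have set: "set \<sigma> = {1..n}" using \<sigma> by (rule permutations_of_setD(1))
  have in_range: "\<sigma> ! i \<in> {1..n}" using set len i nth_mem by blast
  have "(!) \<sigma> ` {k. k < n \<and> \<sigma> ! k < \<sigma> ! i} = {x \<in> set \<sigma>. x < \<sigma> ! i}"
    by (auto simp: set_conv_nth len)
  also have "\<dots> = {1..<\<sigma> ! i}" using in_range by (auto simp: set)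
  finally have "(!) \<sigma> ` {k. k < n \<and> \<sigma> ! k < \<sigma> ! i} = {1..<\<sigma> ! i}" .
  moreover have "inj_on ((!) \<sigma>) {k. k < n \<and> \<sigma> ! k < \<sigma> ! i}"
    by (auto simp: inj_on_def perms_nth_eq_iff[OF \<sigma>])
  ultimately have "card {k. k < n \<and> \<sigma> ! k < \<sigma> ! i} = card {1..<\<sigma> ! i}"
    by (metis card_image)
  then show ?thesis using in_range by simp
qed

text \<open>Each entry is computed from its rank, so the order relation between positions determines
  the permutation. Pairs with \<open>i < k\<close> suffice, since distinct entries make the reversed
  comparison the negation.\<close>

lemma perms_eqI:
  assumes \<sigma>: "\<sigma> \<in> perms n" and \<tau>: "\<tau> \<in> perms n"
    and less: "\<And>i k. i < k \<Longrightarrow> k < n \<Longrightarrow> \<sigma> ! i < \<sigma> ! k \<longleftrightarrow> \<tau> ! i < \<tau> ! k"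
  shows "\<sigma> = \<tau>"
proof (rule nth_equalityI)
  show "length \<sigma> = length \<tau>" using \<sigma> \<tau> by (simp add: perms_length)
  fix i assume "i < length \<sigma>"
  then have i: "i < n" using \<sigma> by (simp add: perms_length)
  have "\<sigma> ! k < \<sigma> ! i \<longleftrightarrow> \<tau> ! k < \<tau> ! i" if k: "k < n" for k
  proof (cases k i rule: linorder_cases)
    case greater
    then show ?thesis
      using less[OF greater k] perms_nth_eq_iff[OF \<sigma> i k] perms_nth_eq_iff[OF \<tau> i k] by linarith
  qed (use less i in auto)
  then have "{k. k < n \<and> \<sigma> ! k < \<sigma> ! i} = {k. k < n \<and> \<tau> ! k < \<tau> ! i}" by blast
  then show "\<sigma> ! i = \<tau> ! i"
    using perms_nth_eq_rank[OF \<sigma> i] perms_nth_eq_rank[OF \<tau> i] by simp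
qed

text \<open>The existence counterpart of \<open>perms_eqI\<close>: replacing each position by its
  rank under \<open>R\<close> gives the required permutation.\<close>

lemma perm_of_strict_order:
  fixes R :: "nat \<Rightarrow> nat \<Rightarrow> bool"
  assumes irrefl: "\<And>i. \<not> R i i"
    and trans: "\<And>i j k. R i j \<Longrightarrow> R j k \<Longrightarrow> R i k"
    and total: "\<And>i j. i \<noteq> j \<Longrightarrow> R i j \<or> R j i"
  obtains \<sigma> where "\<sigma> \<in> perms n" "\<And>i j. i < n \<Longrightarrow> j < n \<Longrightarrow> \<sigma> ! i < \<sigma> ! j \<longleftrightarrow> R i j"
proof -
  define rank where "rank i = Suc (card {k. k < n \<and> R k i})" for i
  have mono: "rank i < rank j" if "R i j" "i < n" for i j
  proof -
    \<comment> \<open>Inclusion is transitivity; it is strict because \<open>i\<close> lies only in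
      the right-hand set.\<close>
    have "{k. k < n \<and> R k i} \<subset> {k. k < n \<and> R k j}"
      using that irrefl trans by blast
    then show ?thesis by (simp add: rank_def psubset_card_mono)
  qed
  have less_iff: "rank i < rank j \<longleftrightarrow> R i j" if "i < n" "j < n" for i j
    using mono[of i j] mono[of j i] total[of i j] that by fastforce
  have inj: "inj_on rank {..<n}"
    by (rule inj_onI) (metis lessThan_iff less_iff less_irrefl total)
  have le: "rank i \<le> n" if "i < n" for i
  proof -
    have "{k. k < n \<and> R k i} \<subset> {..<n}" using that irrefl by blast
    then have "card {k. k < n \<and> R k i} < card {..<n}" by (intro psubset_card_mono) auto
    then show ?thesis by (simp add: rank_def)
  qed
  have "rank ` {..<n} = {1..n}"
  proof (rule card_subset_eq)
    show "rank ` {..<n} \<subseteq> {1..n}" using le by (auto simp: rank_def)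
    show "card (rank ` {..<n}) = card {1..n}" by (simp add: card_image inj)
  qed simp
  then have "map rank [0..<n] \<in> perms n"
    using inj by (intro permutations_of_setI) (auto simp: distinct_map atLeast0LessThan)
  then show thesis using less_iff by (intro that[of "map rank [0..<n]"]) auto
qed

section \<open>Occurrences of patterns of length three\<close>

lemma all_less_3: "(\<forall>j<length [a, b, c]. P j) \<longleftrightarrow> P 0 \<and> P 1 \<and> P 2"
  by (auto simp: less_Suc_eq numeral_2_eq_2)

text \<open>Since letters and entries are distinct, the three comparisons from left to right already
  fix the reversed ones.\<close>

lemma occurrences_3_iff:
  assumes "\<sigma> \<in> perms n" "distinct [a, b, c]"
  shows "[i, j, k] \<in> occurrences [a, b, c] \<sigma> \<longleftrightarrow> i < j \<and> j < k \<and> k < n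
    \<and> (a < b \<longleftrightarrow> \<sigma> ! i < \<sigma> ! j) \<and> (a < c \<longleftrightarrow> \<sigma> ! i < \<sigma> ! k) \<and> (b < c \<longleftrightarrow> \<sigma> ! j < \<sigma> ! k)"
proof (cases "i < j \<and> j < k \<and> k < n")
  case True
  then have "\<sigma> ! i \<noteq> \<sigma> ! j" "\<sigma> ! i \<noteq> \<sigma> ! k" "\<sigma> ! j \<noteq> \<sigma> ! k"
    by (auto simp: perms_nth_eq_iff[OF assms(1)])
  then show ?thesis using True assms(2) perms_length[OF assms(1)]
    unfolding occurrences_def all_less_3 by auto
next
  case False
  then show ?thesis using perms_length[OF assms(1)] by (auto simp: occurrences_def)
qed

lemma avoids_3_iff:
  assumes "\<sigma> \<in> perms n" "distinct [a, b, c]"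
  shows "avoids \<sigma> [a, b, c] \<longleftrightarrow> (\<forall>i j k. i < j \<longrightarrow> j < k \<longrightarrow> k < n \<longrightarrow>
    \<not> ((a < b \<longleftrightarrow> \<sigma> ! i < \<sigma> ! j) \<and> (a < c \<longleftrightarrow> \<sigma> ! i < \<sigma> ! k) \<and> (b < c \<longleftrightarrow> \<sigma> ! j < \<sigma> ! k)))"
proof -
  have "avoids \<sigma> [a, b, c] \<longleftrightarrow> (\<forall>is. is \<notin> occurrences [a, b, c] \<sigma>)"
    by (auto simp: avoids_def num_occ_def finite_occurrences)
  also have "\<dots> \<longleftrightarrow> (\<forall>i j k. [i, j, k] \<notin> occurrences [a, b, c] \<sigma>)"
  proof (intro iffI allI)
    fix "is" assume none: "\<forall>i j k. [i, j, k] \<notin> occurrences [a, b, c] \<sigma>"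
    show "is \<notin> occurrences [a, b, c] \<sigma>"
    proof
      assume is_occ: "is \<in> occurrences [a, b, c] \<sigma>"
      then have "length is = Suc (Suc (Suc 0))" by (simp add: occurrences_def)
      then obtain i j k where "is = [i, j, k]" by (auto simp: length_Suc_conv)
      with is_occ none show False by blast
    qed
  qed blast
  finally show ?thesis unfolding occurrences_3_iff[OF assms] by blast
qed

section \<open>Avoiders and their encoding by sets\<close>

abbreviation avoiders_132_312 :: "nat \<Rightarrow> nat list set" where
  "avoiders_132_312 n \<equiv> avoiders n {[1,3,2], [3,1,2]}"

text \<open>132 and 312 are the patterns whose last entry lies between the other two. Avoiding both
  means that an entry compares in the same way with any two earlier ones, hence as it does with
  entry 0.\<close>

lemma avoiders_132_312_iff:
  "\<sigma> \<in> avoiders_132_312 n \<longleftrightarrow>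
     \<sigma> \<in> perms n \<and> (\<forall>i k. i < k \<longrightarrow> k < n \<longrightarrow> (\<sigma> ! i < \<sigma> ! k \<longleftrightarrow> k \<in> max_positions n \<sigma>))"
    (is "_ \<longleftrightarrow> _ \<and> ?extremal")
proof (cases "\<sigma> \<in> perms n")
  case True
  have "\<sigma> \<in> avoiders_132_312 n \<longleftrightarrow> avoids \<sigma> [1,3,2] \<and> avoids \<sigma> [3,1,2]"
    using True by (simp add: avoiders_def)
  also have "\<dots> \<longleftrightarrow> (\<forall>i j k. i < j \<longrightarrow> j < k \<longrightarrow> k < n \<longrightarrow>
      (\<sigma> ! i < \<sigma> ! k \<longleftrightarrow> \<sigma> ! j < \<sigma> ! k))" (is "?avoids \<longleftrightarrow> ?not_between")
  proof
    assume av: ?avoids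
    show ?not_between
    proof (intro allI impI)
      fix i j k assume ijk: "i < j" "j < k" "k < n"
      have "\<sigma> ! i < \<sigma> ! j \<longrightarrow> \<sigma> ! i < \<sigma> ! k \<longrightarrow> \<sigma> ! j < \<sigma> ! k"
        using av[THEN conjunct1] True ijk by (simp add: avoids_3_iff)
      moreover have "\<not> \<sigma> ! i < \<sigma> ! j \<longrightarrow> \<sigma> ! j < \<sigma> ! k \<longrightarrow> \<sigma> ! i < \<sigma> ! k"
        using av[THEN conjunct2] True ijk by (auto simp: avoids_3_iff)
      ultimately show "\<sigma> ! i < \<sigma> ! k \<longleftrightarrow> \<sigma> ! j < \<sigma> ! k" by linarith
    qed
  next
    assume ?not_between
    then show ?avoids using True by (simp add: avoids_3_iff)
  qed
  also have "?not_between \<longleftrightarrow> ?extremal"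
  proof
    assume not_between: ?not_between
    show ?extremal
    proof (intro allI impI)
      fix i k assume ik: "i < k" "k < n"
      then have "\<sigma> ! i < \<sigma> ! k \<longleftrightarrow> \<sigma> ! 0 < \<sigma> ! k"
        using not_between[rule_format, of 0 i k] by (cases "i = 0") auto
      also have "\<dots> \<longleftrightarrow> k \<in> max_positions n \<sigma>" using ik by (simp add: max_positions_def)
      finally show "\<sigma> ! i < \<sigma> ! k \<longleftrightarrow> k \<in> max_positions n \<sigma>" .
    qed
  next
    assume extremal: ?extremal
    show ?not_between
    proof (intro allI impI)
      fix i j k assume "i < j" "j < k" "k < n"
      then show "\<sigma> ! i < \<sigma> ! k \<longleftrightarrow> \<sigma> ! j < \<sigma> ! k"
        using extremal[rule_format, of i k] extremal[rule_format, of j k] by simp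
    qed
  qed
  finally show ?thesis using True by simp
qed (simp add: avoiders_def)

lemma bij_betw_max_positions:
  "bij_betw (max_positions n) (avoiders_132_312 n) (Pow {1..<n})"
proof (rule bij_betw_imageI)
  show "inj_on (max_positions n) (avoiders_132_312 n)"
  proof (rule inj_onI)
    fix \<sigma> \<tau>
    assume "\<sigma> \<in> avoiders_132_312 n" "\<tau> \<in> avoiders_132_312 n"
      and "max_positions n \<sigma> = max_positions n \<tau>"
    then show "\<sigma> = \<tau>"
      unfolding avoiders_132_312_iff by (intro perms_eqI[of \<sigma> n \<tau>]) simp_all
  qed
  show "max_positions n ` avoiders_132_312 n = Pow {1..<n}"
  proof (intro equalityI subsetI)
    fix A assume A: "A \<in> Pow {1..<n}"
    \<comment> \<open>\<open>R i j\<close> is to become \<open>\<sigma> ! i < \<sigma> ! j\<close>: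
      the later position decides, being above everything before it if it is in \<open>A\<close> and
      below otherwise.\<close>
    define R where "R i j \<longleftrightarrow> (i < j \<and> j \<in> A) \<or> (j < i \<and> i \<notin> A)" for i j
    obtain \<sigma> where \<sigma>: "\<sigma> \<in> perms n" "\<And>i j. i < n \<Longrightarrow> j < n \<Longrightarrow> \<sigma> ! i < \<sigma> ! j \<longleftrightarrow> R i j"
    proof (rule perm_of_strict_order[of R n])
      \<comment> \<open>The middle position \<open>j\<close> cannot be the latest, as it would have
        to be both in \<open>A\<close> and outside it. So \<open>i\<close> or \<open>k\<close> is
        the latest and settles \<open>R i k\<close>.\<close>
      fix i j k assume "R i j" "R j k"
      then show "R i k" unfolding R_def by (metis less_trans linorder_neqE_nat)
    qed (auto simp: R_def)
    have "k \<in> max_positions n \<sigma> \<longleftrightarrow> k \<in> A" for k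
      using A \<sigma>(2)[of 0 k] by (auto simp: max_positions_def R_def)
    moreover have "\<sigma> \<in> avoiders_132_312 n"
      unfolding avoiders_132_312_iff calculation using \<sigma> by (auto simp: R_def)
    ultimately show "A \<in> max_positions n ` avoiders_132_312 n" by blast
  qed (auto simp: max_positions_def)
qed

section \<open>Counting index lists, sets and occurrences\<close>

lemma card_increasing_lists:
  "card {is. length is = m \<and> set is \<subseteq> {0..<n} \<and> sorted_wrt (<) is} = n choose m"
proof -
  have "bij_betw set {is. length is = m \<and> set is \<subseteq> {0..<n} \<and> sorted_wrt (<) is}
      {B. B \<subseteq> {0..<n} \<and> card B = m}"
  proof (rule bij_betw_imageI)
    show "inj_on set {is. length is = m \<and> set is \<subseteq> {0..<n} \<and> sorted_wrt (<) is}"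
      by (rule inj_onI, rule strict_sorted_equal) simp_all
    show "set ` {is. length is = m \<and> set is \<subseteq> {0..<n} \<and> sorted_wrt (<) is}
        = {B. B \<subseteq> {0..<n} \<and> card B = m}"
    proof (intro equalityI subsetI)
      fix B assume "B \<in> {B. B \<subseteq> {0..<n} \<and> card B = m}"
      moreover then have "finite B" by (auto intro: finite_subset)
      ultimately show "B \<in> set ` {is. length is = m \<and> set is \<subseteq> {0..<n} \<and> sorted_wrt (<) is}"
        by (intro image_eqI[of _ _ "sorted_list_of_set B"]) auto
    qed (auto simp: strict_sorted_iff distinct_card)
  qed
  then show ?thesis by (simp add: bij_betw_same_card n_subsets)
qed

lemma card_subsets_two_prescribed:
  assumes "finite S" "x \<in> S" "y \<in> S" "x \<noteq> y"
  shows "card {A \<in> Pow S. (P \<longleftrightarrow> x \<in> A) \<and> (Q \<longleftrightarrow> y \<in> A)} = 2 ^ (card S - 2)"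
proof -
  \<comment> \<open>\<open>C\<close> is the prescribed part of \<open>A\<close> within
    \<open>{x, y}\<close>; the rest is a free subset of \<open>S - {x, y}\<close>.\<close>
  define C where "C = {z. z = x \<and> P \<or> z = y \<and> Q}"
  have "{A \<in> Pow S. (P \<longleftrightarrow> x \<in> A) \<and> (Q \<longleftrightarrow> y \<in> A)} = (\<lambda>B. B \<union> C) ` Pow (S - {x, y})"
  proof (intro equalityI subsetI)
    fix A assume "A \<in> {A \<in> Pow S. (P \<longleftrightarrow> x \<in> A) \<and> (Q \<longleftrightarrow> y \<in> A)}"
    then show "A \<in> (\<lambda>B. B \<union> C) ` Pow (S - {x, y})"
      by (intro image_eqI[of _ _ "A - {x, y}"]) (auto simp: C_def)
  qed (use assms in \<open>auto simp: C_def\<close>)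
  moreover have "inj_on (\<lambda>B. B \<union> C) (Pow (S - {x, y}))"
    by (rule inj_onI) (auto simp: C_def)
  moreover have "card (S - {x, y}) = card S - 2"
    using assms by (simp add: card_Diff_subset)
  ultimately show ?thesis using assms(1) by (simp add: card_image card_Pow)
qed

text \<open>The hypothesis \<open>a < c \<longleftrightarrow> b < c\<close> says that the last
  letter is the largest or the smallest, as the entry at \<open>k\<close> must be relative to those
  at \<open>i\<close> and \<open>j\<close>. The occurrence then amounts to prescribing whether
  \<open>j\<close> and \<open>k\<close> are in the encoding set.\<close>

lemma card_avoiders_with_occurrence:
  assumes q: "distinct [a, b, c]" "a < c \<longleftrightarrow> b < c" and ijk: "i < j" "j < k" "k < n"
  shows "card {\<sigma> \<in> avoiders_132_312 n. [i, j, k] \<in> occurrences [a, b, c] \<sigma>} = 2 ^ (n - 3)"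
proof -
  let ?T = "{A \<in> Pow {1..<n}. (a < b \<longleftrightarrow> j \<in> A) \<and> (a < c \<longleftrightarrow> k \<in> A)}"
  let ?S = "{\<sigma> \<in> avoiders_132_312 n. [i, j, k] \<in> occurrences [a, b, c] \<sigma>}"
  have occ: "[i, j, k] \<in> occurrences [a, b, c] \<sigma> \<longleftrightarrow>
      (a < b \<longleftrightarrow> j \<in> max_positions n \<sigma>) \<and> (a < c \<longleftrightarrow> k \<in> max_positions n \<sigma>)"
    if "\<sigma> \<in> avoiders_132_312 n" for \<sigma>
  proof -
    have "\<sigma> \<in> perms n" "\<sigma> ! i < \<sigma> ! j \<longleftrightarrow> j \<in> max_positions n \<sigma>"
      "\<sigma> ! i < \<sigma> ! k \<longleftrightarrow> k \<in> max_positions n \<sigma>" "\<sigma> ! j < \<sigma> ! k \<longleftrightarrow> k \<in> max_positions n \<sigma>"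
      using that ijk unfolding avoiders_132_312_iff by simp_all
    then show ?thesis using q(2) ijk by (simp add: occurrences_3_iff[OF _ q(1)])
  qed
  have inj: "inj_on (max_positions n) (avoiders_132_312 n)"
    and img: "max_positions n ` avoiders_132_312 n = Pow {1..<n}"
    using bij_betw_max_positions by (auto simp: bij_betw_def)
  have "max_positions n ` ?S = ?T"
    unfolding img[symmetric] using occ by blast
  moreover have "inj_on (max_positions n) ?S"
    using inj by (rule inj_on_subset) blast
  ultimately have "card ?S = card ?T" using card_image[of "max_positions n" ?S] by presburger
  \<comment> \<open>From \<open>i < j < k\<close> both \<open>j\<close> and \<open>k\<close> are
    positive, so they are distinct elements of \<open>{1..<n}\<close>.\<close>
  also have "\<dots> = 2 ^ (card {1..<n} - 2)"
    using ijk by (intro card_subsets_two_prescribed) auto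
  finally show ?thesis by simp
qed

lemma total_occ_last_extremal:
  assumes q: "distinct [a, b, c]" "a < c \<longleftrightarrow> b < c"
  shows "total_occ [a, b, c] n = (n choose 3) * 2 ^ (n - 3)"
proof -
  let ?I = "{is. length is = 3 \<and> set is \<subseteq> {0..<n} \<and> sorted_wrt (<) is}"
  have fin_I: "finite ?I"
    by (rule finite_subset[OF _ finite_lists_length_eq[of "{0..<n}" 3]]) auto
  have fin: "finite (avoiders_132_312 n)" by (simp add: avoiders_def)
  have "num_occ [a, b, c] \<sigma> = card {is \<in> ?I. is \<in> occurrences [a, b, c] \<sigma>}"
    if "\<sigma> \<in> avoiders_132_312 n" for \<sigma>
  proof -
    have "length \<sigma> = n" using that by (simp add: avoiders_def perms_length)
    then have "occurrences [a, b, c] \<sigma> = {is \<in> ?I. is \<in> occurrences [a, b, c] \<sigma>}"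
      by (auto simp: occurrences_def)
    then show ?thesis by (simp add: num_occ_def)
  qed
  then have "total_occ [a, b, c] n
      = (\<Sum>\<sigma>\<in>avoiders_132_312 n. card {is \<in> ?I. is \<in> occurrences [a, b, c] \<sigma>})"
    by (simp add: total_occ_def)
  also have "\<dots> = 2 ^ (n - 3) * card ?I"
  \<comment> \<open>Double counting of pairs of an avoider and an index list: every list in
    \<open>?I\<close> contributes the same number of avoiders.\<close>
  proof (rule sum_multicount[OF fin fin_I], intro ballI)
    fix "is" assume "is \<in> ?I"
    moreover then obtain i j k where "is = [i, j, k]"
      by (auto simp: length_Suc_conv eval_nat_numeral)
    ultimately show "card {\<sigma> \<in> avoiders_132_312 n. is \<in> occurrences [a, b, c] \<sigma>} = 2 ^ (n - 3)"
      using card_avoiders_with_occurrence[OF q] by simp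
  qed
  finally show ?thesis by (simp add: card_increasing_lists)
qed

theorem theorem2p14:
  fixes n :: nat
  assumes "n \<ge> 3"
  shows "total_occ [1,2,3] n = (n choose 3) * 2 ^ (n - 3)
       \<and> total_occ [3,2,1] n = (n choose 3) * 2 ^ (n - 3)
       \<and> total_occ [2,1,3] n = (n choose 3) * 2 ^ (n - 3)
       \<and> total_occ [2,3,1] n = (n choose 3) * 2 ^ (n - 3)"
  \<comment> \<open>Each of the four patterns ends in its largest letter 3 or its smallest letter
    1.\<close>
  by (intro conjI total_occ_last_extremal) simp_all

end
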